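(* Let $(G,p)$ be a framework in $\mathbb{E}^d$ and let $(G*o,\overline{p}^* )$ be its cone framework in $\mathbb{E}^{d+1}$. Then: (i) the space of infinitesimal motions of $(G,p)$ in $\mathbb{E}^{d}$ is isomorphic to the space of infinitesimal motions of the cone framework $(G*o,\overline{p}^* )$ in $\mathbb{E}^{d+1}$ with the cone joint fixed at the origin; (ii) the space of trivial infinitesimal motions of $(G,p)$ in $\mathbb{E}^{d}$ is isomorphic to the space of trivial infinitesimal motions of $(G*o,\overline{p}^* )$ in $\mathbb{E}^{d+1}$ with the cone joint fixed at the origin; (iii) $(G,p)$ has a non-trivial infinitesimal motion in $\mathbb{E}^{d}$ if and only if $(G*o,\overline{p}^* )$ has a non-trivial infinitesimal motion in $\mathbb{E}^{d+1}$; (iv) the space of self-stresses of the framework $(G,p)$ is isomorphic to the space of self-stresses of $(G*o,\overline{p}^* )$; (v) $(G,p)$ is infinitesimally rigid (respectively, isostatic) in $\mathbb{E}^{d}$ if and only if $(G*o,\overline{p}^* )$ is infinitesimally rigid (respectively, isostatic) in $\mathbb{E}^{d+1}$.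
   Context: A framework $(G,p)$ in $\mathbb{E}^d$ (Euclidean $d$-space) is a finite simple graph $G$ with vertex set $V(G)=\{1,\dots,n\}$ and edge set $E(G)$, together with an injective map $p:V(G)\to\mathbb{E}^d$; write $p_i=p(i)$. An infinitesimal motion of $(G,p)$ is a map $u:V(G)\to\mathbb{E}^d$ with $(p_i-p_j)\cdot(u_i-u_j)=0$ for all $\{i,j\}\in E(G)$. It is trivial if there are a skew-symmetric $d\times d$ matrix $A$ and a vector $t\in\mathbb{E}^d$ with $u_i=Ap_i+t$ for all $i$; otherwise it is non-trivial. $(G,p)$ is infinitesimally rigid if every infinitesimal motion is trivial. A self-stress is a function $\omega:E(G)\to\mathbb{R}$ with $\sum_{j:\{i,j\}\in E(G)}\omega_{ij}(p_i-p_j)=0$ for every vertex $i$. $(G,p)$ is independent if its only self-stress is $0$, and isostatic if it is independent and infinitesimally rigid. The cone graph $G*o$ is obtained from $G$ by adding a new vertex $o$ (also written $0$) adjacent to all vertices of $G$. The cone framework $(G*o,\overline{p}^* )$ in $\mathbb{E}^{d+1}$ places vertex $i\in V(G)$ at $\overline{p}_i=(p_i,1)$ and the cone joint $o$ at the origin. "With the cone joint fixed at the origin" means that only infinitesimal motions $u$ with $u_o=0$ are considered. *)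

theory Defs
  imports "HOL-Analysis.Analysis" "HOL-Library.Function_Algebras"
begin

text \<open>Pointwise real vector space structure on functions, so that spaces of motions and of
  self-stresses can be treated as linear subspaces.\<close>

instantiation "fun" :: (type, real_vector) real_vector
begin

definition scaleR_fun :: "real \<Rightarrow> ('a \<Rightarrow> 'b) \<Rightarrow> 'a \<Rightarrow> 'b" where
  "scaleR_fun c f = (\<lambda>x. c *\<^sub>R f x)"

instance
  by standard (auto simp: scaleR_fun_def fun_eq_iff scaleR_add_right scaleR_add_left)

end

definition subspace_isomorphic ::
    "'a::real_vector set \<Rightarrow> 'b::real_vector set \<Rightarrow> bool" where
  "subspace_isomorphic S T \<longleftrightarrow> subspace S \<and> subspace T \<and>
     (\<exists>\<phi>. bij_betw \<phi> S T \<and>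
        (\<forall>u\<in>S. \<forall>v\<in>S. \<phi> (u + v) = \<phi> u + \<phi> v) \<and>
        (\<forall>c. \<forall>u\<in>S. \<phi> (c *\<^sub>R u) = c *\<^sub>R \<phi> u))"

definition simple_graph :: "'v set \<Rightarrow> 'v set set \<Rightarrow> bool" where
  "simple_graph V E \<longleftrightarrow> finite V \<and> (\<forall>e\<in>E. \<exists>i\<in>V. \<exists>j\<in>V. i \<noteq> j \<and> e = {i, j})"

definition framework :: "'v set \<Rightarrow> 'v set set \<Rightarrow> ('v \<Rightarrow> real ^ 'm) \<Rightarrow> bool" where
  "framework V E p \<longleftrightarrow> simple_graph V E \<and> inj_on p V"

text \<open>A map on \<open>V\<close> is represented by the total function that is zero off \<open>V\<close>;
  likewise a function on \<open>E\<close>. This makes equality of representatives equality of maps.\<close>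

definition inf_motions ::
    "'v set \<Rightarrow> 'v set set \<Rightarrow> ('v \<Rightarrow> real ^ 'm) \<Rightarrow> ('v \<Rightarrow> real ^ 'm) set" where
  "inf_motions V E p =
     {u. (\<forall>i. i \<notin> V \<longrightarrow> u i = 0) \<and>
         (\<forall>i\<in>V. \<forall>j\<in>V. {i, j} \<in> E \<longrightarrow> (p i - p j) \<bullet> (u i - u j) = 0)}"

definition trivial_inf_motions ::
    "'v set \<Rightarrow> 'v set set \<Rightarrow> ('v \<Rightarrow> real ^ 'm) \<Rightarrow> ('v \<Rightarrow> real ^ 'm) set" where
  "trivial_inf_motions V E p =
     {u \<in> inf_motions V E p.
        \<exists>(A :: real ^ 'm ^ 'm) t. transpose A = - A \<and> (\<forall>i\<in>V. u i = A *v p i + t)}"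

definition has_nontrivial_inf_motion ::
    "'v set \<Rightarrow> 'v set set \<Rightarrow> ('v \<Rightarrow> real ^ 'm) \<Rightarrow> bool" where
  "has_nontrivial_inf_motion V E p \<longleftrightarrow>
     (\<exists>u \<in> inf_motions V E p. u \<notin> trivial_inf_motions V E p)"

definition inf_rigid :: "'v set \<Rightarrow> 'v set set \<Rightarrow> ('v \<Rightarrow> real ^ 'm) \<Rightarrow> bool" where
  "inf_rigid V E p \<longleftrightarrow> (\<forall>u \<in> inf_motions V E p. u \<in> trivial_inf_motions V E p)"

definition self_stresses ::
    "'v set \<Rightarrow> 'v set set \<Rightarrow> ('v \<Rightarrow> real ^ 'm) \<Rightarrow> ('v set \<Rightarrow> real) set" where
  "self_stresses V E p =
     {\<omega>. (\<forall>e. e \<notin> E \<longrightarrow> \<omega> e = 0) \<and>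
         (\<forall>i\<in>V. (\<Sum>j \<in> {j \<in> V. {i, j} \<in> E}. \<omega> {i, j} *\<^sub>R (p i - p j)) = 0)}"

definition stress_independent :: "'v set \<Rightarrow> 'v set set \<Rightarrow> ('v \<Rightarrow> real ^ 'm) \<Rightarrow> bool" where
  "stress_independent V E p \<longleftrightarrow> self_stresses V E p = {0}"

definition isostatic :: "'v set \<Rightarrow> 'v set set \<Rightarrow> ('v \<Rightarrow> real ^ 'm) \<Rightarrow> bool" where
  "isostatic V E p \<longleftrightarrow> stress_independent V E p \<and> inf_rigid V E p"

text \<open>The cone joint is the vertex \<open>0\<close>; the vertices of the base graph are positive.
  Euclidean space of dimension \<open>CARD('d) + 1\<close> is indexed by \<open>'d option\<close>, where \<open>None\<close>
  is the additional last coordinate.\<close>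

definition cone_vertices :: "nat set \<Rightarrow> nat set" where
  "cone_vertices V = insert 0 V"

definition cone_edges :: "nat set \<Rightarrow> nat set set \<Rightarrow> nat set set" where
  "cone_edges V E = E \<union> {{0, i} | i. i \<in> V}"

definition cone_placement :: "(nat \<Rightarrow> real ^ 'd) \<Rightarrow> nat \<Rightarrow> real ^ ('d option)" where
  "cone_placement p i =
     (if i = 0 then 0 else (\<chi> k. case k of Some l \<Rightarrow> p i $ l | None \<Rightarrow> 1))"

lemma framework_cone:
  assumes "framework V E p" "0 \<notin> V"
  shows "framework (cone_vertices V) (cone_edges V E) (cone_placement p)"
proof -
  have nz: "cone_placement p i \<noteq> 0" if "i \<in> V" for i
  proof
    assume "cone_placement p i = 0"
    then have "cone_placement p i $ None = 0" by simp
    with that assms(2) show False by (auto simp: cone_placement_def split: if_splits)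
  qed
  have inj: "i = j" if "i \<in> V" "j \<in> V" "cone_placement p i = cone_placement p j" for i j
  proof -
    have "cone_placement p i $ Some l = cone_placement p j $ Some l" for l
      using that by simp
    moreover have "i \<noteq> 0" "j \<noteq> 0" using that(1,2) assms(2) by metis+
    ultimately have "p i $ l = p j $ l" for l
      by (simp add: cone_placement_def)
    then have "p i = p j" by (simp add: vec_eq_iff)
    with that assms(1) show ?thesis by (auto simp: framework_def inj_on_def)
  qed
  have zero: "cone_placement p 0 = 0" by (simp add: cone_placement_def)
  have "inj_on (cone_placement p) V"
    using inj by (rule inj_onI)
  moreover have "cone_placement p 0 \<notin> cone_placement p ` V"
  proof
    assume "cone_placement p 0 \<in> cone_placement p ` V"
    then obtain i where "i \<in> V" "cone_placement p 0 = cone_placement p i" by (rule imageE)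
    with nz[of i] zero show False by simp
  qed
  ultimately have "inj_on (cone_placement p) (insert 0 V)"
    using assms(2) by simp
  moreover have "simple_graph (insert 0 V) (cone_edges V E)"
    unfolding simple_graph_def
  proof (intro conjI ballI)
    show "finite (insert 0 V)"
      using assms(1) by (simp add: framework_def simple_graph_def)
    fix e assume "e \<in> cone_edges V E"
    then consider "e \<in> E" | i where "i \<in> V" "e = {0, i}"
      by (auto simp: cone_edges_def)
    then show "\<exists>i\<in>insert 0 V. \<exists>j\<in>insert 0 V. i \<noteq> j \<and> e = {i, j}"
    proof cases
      case 1
      then have "\<exists>i\<in>V. \<exists>j\<in>V. i \<noteq> j \<and> e = {i, j}"
        using assms(1) by (simp add: framework_def simple_graph_def)
      then show ?thesis by blast
    next
      case 2
      with assms(2) have "0 \<noteq> i" by metis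
      with 2 show ?thesis by blast
    qed
  qed
  ultimately show ?thesis by (simp add: framework_def cone_vertices_def)
qed

end

theory Submission
  imports Defs
begin

text \<open>
  Fixing the cone joint at the origin turns the edge condition for the edge from the joint to
  \<open>i\<close> into \<open>(p\<^sub>i, 1) \<bullet> v\<^sub>i = 0\<close>. This determines the last coordinate of \<open>v\<^sub>i\<close> as \<open>- p\<^sub>i \<bullet> u\<^sub>i\<close>, where
  \<open>u\<^sub>i\<close> consists of the other coordinates. The last coordinate of \<open>(p\<^sub>i, 1) - (p\<^sub>j, 1)\<close> vanishes, so
  the remaining conditions say that \<open>u\<close> is a motion of the base framework. Hence
  \<open>u \<mapsto> (u, - p \<bullet> u)\<close> is an isomorphism of the spaces of motions (lemmas \<open>cone_motion_image\<close> and
  \<open>linear_cone_motion\<close>).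

  It matches the trivial motions (lemma \<open>cone_motion_trivial_iff\<close>): a skew matrix in one dimension
  more consists of a skew block \<open>A\<close>, a last column \<open>(t, 0)\<close>, and a last row \<open>(- t, 0)\<close>, and it sends \<open>(p\<^sub>i, 1)\<close> to
  \<open>(A p\<^sub>i + t, - t \<bullet> p\<^sub>i)\<close>. Since \<open>p\<^sub>i \<bullet> A p\<^sub>i = 0\<close>, this is the image of \<open>A p\<^sub>i + t\<close>.
  Any motion of the cone becomes one that fixes the joint after subtraction of a
  translation, which does not affect triviality. Thus infinitesimal rigidity transfers in both
  directions.

  For stresses, the last coordinate of the equilibrium condition at a base vertex \<open>i\<close> forces the
  stress on the edge from the joint to \<open>i\<close> to vanish; conversely a base stress extended by zero is
  in equilibrium. The two spaces of stresses, as functions on all sets of vertices, are equal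
  (lemma \<open>self_stresses_cone\<close>).
\<close>

section \<open>Vectors with one additional coordinate\<close>

text \<open>The vector \<open>(x, c)\<close> with the additional coordinate \<open>c\<close> at index \<open>None\<close>.\<close>

definition extend_vec :: "real ^ 'd \<Rightarrow> real \<Rightarrow> real ^ ('d option)" where
  "extend_vec x c = (\<chi> k. case k of Some l \<Rightarrow> x $ l | None \<Rightarrow> c)"

text \<open>The projection that forgets the additional coordinate.\<close>

definition base_vec :: "real ^ ('d option) \<Rightarrow> real ^ 'd" where
  "base_vec x = (\<chi> l. x $ Some l)"

lemma extend_vec_nth [simp]:
  "extend_vec x c $ None = c" "extend_vec x c $ Some l = x $ l"
  by (simp_all add: extend_vec_def)

lemma base_vec_nth [simp]: "base_vec x $ l = x $ Some l"
  by (simp add: base_vec_def)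

lemma vec_option_eq_iff:
  fixes x y :: "'a ^ ('d::finite option)"
  shows "x = y \<longleftrightarrow> x $ None = y $ None \<and> (\<forall>l. x $ Some l = y $ Some l)"
  unfolding vec_eq_iff by (metis option.exhaust)

lemma base_extend_vec [simp]: "base_vec (extend_vec x c) = x"
  by (simp add: vec_eq_iff)

lemma extend_base_vec: "extend_vec (base_vec x) (x $ None) = x"
  by (simp add: vec_option_eq_iff)

lemma base_vec_zero [simp]: "base_vec 0 = 0"
  by (simp add: vec_eq_iff)

lemma base_vec_diff: "base_vec (x - y) = base_vec x - base_vec y"
  by (simp add: vec_eq_iff)

lemma extend_vec_zero [simp]: "extend_vec 0 0 = 0"
  by (simp add: vec_option_eq_iff)

lemma extend_vec_eq_0_iff: "extend_vec x c = 0 \<longleftrightarrow> x = 0 \<and> c = 0"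
  by (auto simp: vec_option_eq_iff vec_eq_iff)

lemma extend_vec_diff: "extend_vec x c - extend_vec y e = extend_vec (x - y) (c - e)"
  by (simp add: vec_option_eq_iff)

lemma sum_option_UNIV:
  fixes f :: "'d::finite option \<Rightarrow> 'a::comm_monoid_add"
  shows "(\<Sum>k\<in>UNIV. f k) = f None + (\<Sum>l\<in>UNIV. f (Some l))"
  by (simp add: UNIV_option_conv sum.reindex)

lemma inner_extend_vec: "extend_vec x c \<bullet> y = x \<bullet> base_vec y + c * y $ None"
  by (simp add: inner_vec_def sum_option_UNIV)

lemma cone_placement_0 [simp]: "cone_placement p 0 = 0"
  by (simp add: cone_placement_def)

lemma cone_placement_base: "i \<noteq> 0 \<Longrightarrow> cone_placement p i = extend_vec (p i) 1"
  by (simp add: cone_placement_def extend_vec_def)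

section \<open>Skew matrices\<close>

lemma skew_iff:
  fixes A :: "real ^ 'd ^ 'd"
  shows "transpose A = - A \<longleftrightarrow> (\<forall>i j. A $ i $ j + A $ j $ i = 0)"
  by (simp add: vec_eq_iff transpose_def eq_neg_iff_add_eq_0) (metis add.commute)

lemma skew_inner_self:
  fixes A :: "real ^ 'd ^ 'd"
  assumes "transpose A = - A"
  shows "x \<bullet> (A *v x) = 0"
proof -
  have "x \<bullet> (A *v x) = (transpose A *v x) \<bullet> x"
    by (simp add: dot_lmul_matrix transpose_matrix_vector)
  also have "\<dots> = - (x \<bullet> (A *v x))"
    unfolding assms
    by (simp add: inner_vec_def matrix_vector_mult_def sum_negf mult.commute)
  finally show ?thesis by simp
qed

text \<open>The block matrix with rows \<open>(A, t)\<close> and \<open>(- t, 0)\<close>.\<close>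

definition extend_matrix :: "real ^ 'd ^ 'd \<Rightarrow> real ^ 'd \<Rightarrow> real ^ ('d option) ^ ('d option)" where
  "extend_matrix A t = (\<chi> k. case k of Some l \<Rightarrow> extend_vec (A $ l) (t $ l) | None \<Rightarrow> extend_vec (- t) 0)"

lemma extend_matrix_mult_extend_vec:
  "extend_matrix A t *v extend_vec x c = extend_vec (A *v x + c *\<^sub>R t) (- (x \<bullet> t))"
  by (simp add: vec_option_eq_iff extend_matrix_def matrix_vector_mult_def sum_option_UNIV
      inner_vec_def sum_negf mult.commute)

lemma skew_extend_matrix:
  assumes "transpose A = - A"
  shows "transpose (extend_matrix A t) = - extend_matrix A t"
  using assms unfolding skew_iff
  by (auto simp: extend_matrix_def split: option.split)

lemma base_vec_matrix_mult_extend_vec: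
  "base_vec (B *v extend_vec x c) =
    (\<chi> k l. B $ Some k $ Some l) *v x + c *\<^sub>R (\<chi> k. B $ Some k $ None)"
  by (simp add: vec_eq_iff matrix_vector_mult_def sum_option_UNIV mult.commute)

section \<open>Subspaces of motions\<close>

lemma subspace_inf_motions: "subspace (inf_motions V E p)"
proof (rule subspaceI)
  show "0 \<in> inf_motions V E p"
    by (simp add: inf_motions_def)
next
  fix u v assume "u \<in> inf_motions V E p" "v \<in> inf_motions V E p"
  moreover have "(p i - p j) \<bullet> ((u + v) i - (u + v) j) =
      (p i - p j) \<bullet> (u i - u j) + (p i - p j) \<bullet> (v i - v j)" for i j
    by (simp only: plus_fun_apply add_diff_add inner_add_right)
  ultimately show "u + v \<in> inf_motions V E p"
    by (simp add: inf_motions_def)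
next
  fix c u assume "u \<in> inf_motions V E p"
  moreover have "(p i - p j) \<bullet> ((c *\<^sub>R u) i - (c *\<^sub>R u) j) = c * ((p i - p j) \<bullet> (u i - u j))" for i j
    by (simp only: scaleR_fun_def scaleR_diff_right[symmetric] inner_scaleR_right)
  ultimately show "c *\<^sub>R u \<in> inf_motions V E p"
    by (simp add: inf_motions_def) (simp add: scaleR_fun_def)
qed

lemma subspace_trivial_inf_motions: "subspace (trivial_inf_motions V E p)"
proof (rule subspaceI)
  have "transpose (0 :: real ^ 'b ^ 'b) = - 0"
    by (simp add: vec_eq_iff transpose_def)
  moreover have "\<forall>i\<in>V. (0 :: 'a \<Rightarrow> real ^ 'b) i = 0 *v p i + 0"
    by simp
  ultimately show "0 \<in> trivial_inf_motions V E p"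
    using subspace_0[OF subspace_inf_motions] unfolding trivial_inf_motions_def by blast
next
  fix u v
  assume u: "u \<in> trivial_inf_motions V E p" and v: "v \<in> trivial_inf_motions V E p"
  obtain A s where A: "transpose A = - A" "\<forall>i\<in>V. u i = A *v p i + s"
    using u unfolding trivial_inf_motions_def by blast
  obtain B t where B: "transpose B = - B" "\<forall>i\<in>V. v i = B *v p i + t"
    using v unfolding trivial_inf_motions_def by blast
  have "(A + B) $ i $ j + (A + B) $ j $ i = (A $ i $ j + A $ j $ i) + (B $ i $ j + B $ j $ i)" for i j
    by simp
  then have "transpose (A + B) = - (A + B)"
    using A(1) B(1) unfolding skew_iff by simp
  moreover have "\<forall>i\<in>V. (u + v) i = (A + B) *v p i + (s + t)"
    using A(2) B(2) by (simp add: matrix_vector_mult_add_rdistrib algebra_simps)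
  moreover have "u + v \<in> inf_motions V E p"
    using u v subspace_add[OF subspace_inf_motions] unfolding trivial_inf_motions_def by blast
  ultimately show "u + v \<in> trivial_inf_motions V E p"
    unfolding trivial_inf_motions_def by blast
next
  fix c u
  assume u: "u \<in> trivial_inf_motions V E p"
  obtain A s where A: "transpose A = - A" "\<forall>i\<in>V. u i = A *v p i + s"
    using u unfolding trivial_inf_motions_def by blast
  have "transpose (c *\<^sub>R A) = - (c *\<^sub>R A)"
    using A(1) unfolding skew_iff by (simp flip: distrib_left)
  moreover have "\<forall>i\<in>V. (c *\<^sub>R u) i = (c *\<^sub>R A) *v p i + c *\<^sub>R s"
    using A(2) by (simp add: scaleR_fun_def scaleR_add_right scaleR_matrix_vector_assoc)
  moreover have "c *\<^sub>R u \<in> inf_motions V E p"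
    using u subspace_scale[OF subspace_inf_motions] unfolding trivial_inf_motions_def by blast
  ultimately show "c *\<^sub>R u \<in> trivial_inf_motions V E p"
    unfolding trivial_inf_motions_def by blast
qed

lemma subspace_isomorphic_linear_image:
  assumes "linear f" "subspace S" "inj_on f S" "f ` S = T"
  shows "subspace_isomorphic S T"
  unfolding subspace_isomorphic_def
  using assms linear_subspace_image[OF assms(1,2)] linear_add[OF assms(1)] linear_scale[OF assms(1)]
  by (auto simp: bij_betw_def)

section \<open>Motions of the cone\<close>

text \<open>The motion \<open>i \<mapsto> (u\<^sub>i, - p\<^sub>i \<bullet> u\<^sub>i)\<close>. It vanishes wherever \<open>u\<close> does, in particular at the cone
  joint \<open>0\<close> if \<open>u\<close> is a motion of a base framework of which \<open>0\<close> is not a vertex.\<close>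

definition cone_motion :: "('v \<Rightarrow> real ^ 'd) \<Rightarrow> ('v \<Rightarrow> real ^ 'd) \<Rightarrow> 'v \<Rightarrow> real ^ ('d option)" where
  "cone_motion p u i = extend_vec (u i) (- (p i \<bullet> u i))"

lemma linear_cone_motion: "linear (cone_motion p)"
  by (rule linearI)
    (simp_all add: fun_eq_iff cone_motion_def vec_option_eq_iff scaleR_fun_def inner_add_right)

lemma inj_cone_motion: "inj (cone_motion p)"
proof (rule injI)
  fix u v assume "cone_motion p u = cone_motion p v"
  then have "base_vec (cone_motion p u i) = base_vec (cone_motion p v i)" for i by simp
  then show "u = v" by (simp add: cone_motion_def fun_eq_iff)
qed

lemma mem_cone_edges_base:
  assumes "0 \<notin> V" "i \<in> V" "j \<in> V"
  shows "{i, j} \<in> cone_edges V E \<longleftrightarrow> {i, j} \<in> E"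
  using assms by (auto simp: cone_edges_def doubleton_eq_iff)

lemma inf_motions_cone_fixed_iff:
  assumes V: "0 \<notin> V" and v0: "v 0 = 0"
  shows "v \<in> inf_motions (cone_vertices V) (cone_edges V E) (cone_placement p) \<longleftrightarrow>
    (\<forall>i. i \<notin> V \<longrightarrow> v i = 0) \<and> (\<forall>i\<in>V. extend_vec (p i) 1 \<bullet> v i = 0) \<and>
    (\<forall>i\<in>V. \<forall>j\<in>V. {i, j} \<in> E \<longrightarrow> (p i - p j) \<bullet> (base_vec (v i) - base_vec (v j)) = 0)"
    (is "?L \<longleftrightarrow> ?R")
proof -
  have nz: "i \<noteq> 0" if "i \<in> V" for i using that V by metis
  have joint: "{0, i} \<in> cone_edges V E" "{i, 0} \<in> cone_edges V E" if "i \<in> V" for i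
    using that by (auto simp: cone_edges_def insert_commute)
  have edge: "(cone_placement p i - cone_placement p j) \<bullet> (v i - v j) =
      (p i - p j) \<bullet> (base_vec (v i) - base_vec (v j))" if "i \<in> V" "j \<in> V" for i j
    using that nz by (simp add: cone_placement_base extend_vec_diff inner_extend_vec base_vec_diff)
  show ?thesis
  proof
    assume L: ?L
    have "extend_vec (p i) 1 \<bullet> v i = 0" if "i \<in> V" for i
    proof -
      have "(cone_placement p i - cone_placement p 0) \<bullet> (v i - v 0) = 0"
        using L joint(2)[OF that] that unfolding inf_motions_def cone_vertices_def by blast
      then show ?thesis using nz[OF that] v0 by (simp add: cone_placement_base)
    qed
    moreover have "(p i - p j) \<bullet> (base_vec (v i) - base_vec (v j)) = 0"
      if "i \<in> V" "j \<in> V" "{i, j} \<in> E" for i j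
    proof -
      have "(cone_placement p i - cone_placement p j) \<bullet> (v i - v j) = 0"
        using L that mem_cone_edges_base[OF V that(1,2)]
        unfolding inf_motions_def cone_vertices_def by blast
      then show ?thesis using edge that by simp
    qed
    moreover have "v i = 0" if "i \<notin> V" for i
      using L v0 that unfolding inf_motions_def cone_vertices_def by (cases "i = 0") auto
    ultimately show ?R by blast
  next
    assume R: ?R
    have "(cone_placement p i - cone_placement p j) \<bullet> (v i - v j) = 0"
      if ij: "i \<in> insert 0 V" "j \<in> insert 0 V" "{i, j} \<in> cone_edges V E" for i j
    proof -
      consider "i = 0" "j = 0" | "i = 0" "j \<in> V" | "i \<in> V" "j = 0" | "i \<in> V" "j \<in> V"
        using ij(1,2) by blast
      then show ?thesis
      proof cases
        case 4
        then show ?thesis using R edge ij(3) mem_cone_edges_base[OF V 4] by simp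
      qed (use R nz v0 in \<open>simp_all add: cone_placement_base\<close>)
    qed
    then show ?L using R unfolding inf_motions_def cone_vertices_def by blast
  qed
qed

lemma cone_motion_image:
  assumes V: "0 \<notin> V"
  shows "cone_motion p ` inf_motions V E p =
    {v \<in> inf_motions (cone_vertices V) (cone_edges V E) (cone_placement p). v 0 = 0}"
proof (intro equalityI subsetI)
  fix v assume "v \<in> cone_motion p ` inf_motions V E p"
  then obtain u where u: "u \<in> inf_motions V E p" and v: "v = cone_motion p u" by blast
  have zero: "\<forall>i. i \<notin> V \<longrightarrow> v i = 0"
    using u by (simp add: v inf_motions_def cone_motion_def)
  then have v0: "v 0 = 0" using V by simp
  have "v \<in> inf_motions (cone_vertices V) (cone_edges V E) (cone_placement p)"
    unfolding inf_motions_cone_fixed_iff[OF V, of v, OF v0]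
    using zero u by (auto simp: v cone_motion_def inner_extend_vec inf_motions_def)
  with v0 show "v \<in> {v \<in> inf_motions (cone_vertices V) (cone_edges V E) (cone_placement p). v 0 = 0}"
    by simp
next
  fix v
  assume "v \<in> {v \<in> inf_motions (cone_vertices V) (cone_edges V E) (cone_placement p). v 0 = 0}"
  then have mot: "v \<in> inf_motions (cone_vertices V) (cone_edges V E) (cone_placement p)"
    and v0: "v 0 = 0" by auto
  note R = mot[unfolded inf_motions_cone_fixed_iff[OF V, of v, OF v0]]
  have "v i = cone_motion p (\<lambda>i. base_vec (v i)) i" for i
  proof (cases "i \<in> V")
    case True
    then have "p i \<bullet> base_vec (v i) + v i $ None = 0"
      using R by (simp add: inner_extend_vec)
    then have "v i $ None = - (p i \<bullet> base_vec (v i))" by linarith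
    then show ?thesis
      using extend_base_vec[of "v i"] by (simp add: cone_motion_def)
  next
    case False
    then show ?thesis using R by (simp add: cone_motion_def)
  qed
  then have "v = cone_motion p (\<lambda>i. base_vec (v i))" by (rule ext)
  moreover have "(\<lambda>i. base_vec (v i)) \<in> inf_motions V E p"
    using R by (simp add: inf_motions_def)
  ultimately show "v \<in> cone_motion p ` inf_motions V E p" by (rule image_eqI)
qed

lemma cone_motion_trivial_iff:
  assumes V: "0 \<notin> V" and u: "u \<in> inf_motions V E p"
  shows "cone_motion p u \<in>
      trivial_inf_motions (cone_vertices V) (cone_edges V E) (cone_placement p) \<longleftrightarrow>
    u \<in> trivial_inf_motions V E p" (is "?L \<longleftrightarrow> ?R")
proof
  have nz: "i \<noteq> 0" if "i \<in> V" for i using that V by metis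
  have "cone_motion p u \<in> cone_motion p ` inf_motions V E p" using u by (rule imageI)
  then have mot: "cone_motion p u \<in> inf_motions (cone_vertices V) (cone_edges V E) (cone_placement p)"
    and u0: "cone_motion p u 0 = 0"
    unfolding cone_motion_image[OF V] by auto
  {
    assume ?R
    then obtain A t where A: "transpose A = - A" and t: "\<forall>i\<in>V. u i = A *v p i + t"
      unfolding trivial_inf_motions_def by blast
    have "cone_motion p u i = extend_matrix A t *v cone_placement p i + 0"
      if "i \<in> insert 0 V" for i
    proof (cases "i = 0")
      case True
      then show ?thesis using u0 by simp
    next
      case False
      then have "i \<in> V" using that by simp
      then show ?thesis
        using False t skew_inner_self[OF A, of "p i"]
        by (simp add: cone_motion_def cone_placement_base extend_matrix_mult_extend_vec
            inner_add_right)
    qed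
    then show ?L
      using mot skew_extend_matrix[OF A, of t]
      unfolding trivial_inf_motions_def cone_vertices_def by blast
  }
  {
    assume ?L
    then obtain B s where B: "transpose B = - B"
      and s: "\<forall>i\<in>insert 0 V. cone_motion p u i = B *v cone_placement p i + s"
      unfolding trivial_inf_motions_def cone_vertices_def by blast
    \<comment> \<open>The joint lies at the origin and does not move, so there is no translation part.\<close>
    have s0: "s = 0" using s u0 by simp
    define A where "A = (\<chi> k l. B $ Some k $ Some l)"
    define t where "t = (\<chi> k. B $ Some k $ None)"
    have "transpose A = - A"
      using B unfolding skew_iff by (simp add: A_def)
    moreover have "u i = A *v p i + t" if "i \<in> V" for i
    proof -
      have "cone_motion p u i = B *v extend_vec (p i) 1"
        using s s0 that nz[OF that] by (simp add: cone_placement_base)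
      then have "base_vec (cone_motion p u i) = base_vec (B *v extend_vec (p i) 1)" by simp
      then show ?thesis
        by (simp add: cone_motion_def base_vec_matrix_mult_extend_vec A_def t_def)
    qed
    ultimately show ?R using u unfolding trivial_inf_motions_def by blast
  }
qed

lemma cone_motion_image_trivial:
  assumes V: "0 \<notin> V"
  shows "cone_motion p ` trivial_inf_motions V E p =
    {v \<in> trivial_inf_motions (cone_vertices V) (cone_edges V E) (cone_placement p). v 0 = 0}"
    (is "_ = {v \<in> ?T. v 0 = 0}")
proof -
  have "trivial_inf_motions V E p \<subseteq> inf_motions V E p"
    by (auto simp: trivial_inf_motions_def)
  then have "trivial_inf_motions V E p = {u \<in> inf_motions V E p. cone_motion p u \<in> ?T}"
    using cone_motion_trivial_iff[OF V] by blast
  then have "cone_motion p ` trivial_inf_motions V E p = cone_motion p ` inf_motions V E p \<inter> ?T"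
    by blast
  then show ?thesis
    unfolding cone_motion_image[OF V] by (auto simp: trivial_inf_motions_def)
qed

lemma translation_trivial_inf_motion:
  "(\<lambda>i. if i \<in> V then t else 0) \<in> trivial_inf_motions V E p"
proof -
  have "transpose (0 :: real ^ 'b ^ 'b) = - 0"
    by (simp add: vec_eq_iff transpose_def)
  moreover have "\<forall>i\<in>V. (if i \<in> V then t else 0) = 0 *v p i + t"
    by simp
  moreover have "(\<lambda>i. if i \<in> V then t else 0) \<in> inf_motions V E p"
    by (simp add: inf_motions_def)
  ultimately show ?thesis unfolding trivial_inf_motions_def by blast
qed

lemma inf_rigid_cone_iff:
  assumes V: "0 \<notin> V"
  shows "inf_rigid (cone_vertices V) (cone_edges V E) (cone_placement p) \<longleftrightarrow> inf_rigid V E p"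
    (is "?L \<longleftrightarrow> ?R")
proof
  assume ?L
  then show ?R
    unfolding inf_rigid_def
    using cone_motion_image[OF V] cone_motion_trivial_iff[OF V] by blast
next
  let ?M = "inf_motions (cone_vertices V) (cone_edges V E) (cone_placement p)"
  let ?T = "trivial_inf_motions (cone_vertices V) (cone_edges V E) (cone_placement p)"
  assume R: ?R
  show ?L
    unfolding inf_rigid_def
  proof
    fix v assume v: "v \<in> ?M"
    \<comment> \<open>The translation that agrees with \<open>v\<close> at the cone joint.\<close>
    define s where "s = (\<lambda>i. if i \<in> cone_vertices V then v 0 else 0)"
    have s: "s \<in> ?T" unfolding s_def by (rule translation_trivial_inf_motion)
    then have "v - s \<in> ?M"
      using v subspace_diff[OF subspace_inf_motions] unfolding trivial_inf_motions_def by blast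
    moreover have "(v - s) 0 = 0" by (simp add: s_def cone_vertices_def)
    ultimately obtain u where u: "u \<in> inf_motions V E p" "v - s = cone_motion p u"
      using cone_motion_image[OF V, of p E] by blast
    then have "v - s \<in> ?T"
      using R cone_motion_trivial_iff[OF V u(1)] unfolding inf_rigid_def by simp
    then have "(v - s) + s \<in> ?T"
      using s by (rule subspace_add[OF subspace_trivial_inf_motions])
    then show "v \<in> ?T" by simp
  qed
qed

lemma has_nontrivial_inf_motion_iff: "has_nontrivial_inf_motion V E p \<longleftrightarrow> \<not> inf_rigid V E p"
  by (auto simp: has_nontrivial_inf_motion_def inf_rigid_def)

section \<open>Stresses of the cone\<close>

lemma subspace_self_stresses: "subspace (self_stresses V E p)"
proof (rule subspaceI)
  show "0 \<in> self_stresses V E p"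
    by (simp add: self_stresses_def)
next
  fix \<omega> \<eta> assume "\<omega> \<in> self_stresses V E p" "\<eta> \<in> self_stresses V E p"
  then show "\<omega> + \<eta> \<in> self_stresses V E p"
    by (simp add: self_stresses_def scaleR_add_left sum.distrib)
next
  fix c \<omega> assume "\<omega> \<in> self_stresses V E p"
  moreover have "(\<Sum>j\<in>N. (c *\<^sub>R \<omega>) {i, j} *\<^sub>R (p i - p j)) =
      c *\<^sub>R (\<Sum>j\<in>N. \<omega> {i, j} *\<^sub>R (p i - p j))" for i N
    by (simp only: scaleR_fun_def scaleR_sum_right scaleR_scaleR real_scaleR_def)
  ultimately show "c *\<^sub>R \<omega> \<in> self_stresses V E p"
    by (simp add: self_stresses_def) (simp add: scaleR_fun_def)
qed

text \<open>The equilibrium sum of the cone at a base vertex. Every edge between base vertices is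
  horizontal, so the last coordinate is the stress on the edge to the joint.\<close>

lemma cone_stress_sum_base:
  fixes p :: "nat \<Rightarrow> real ^ 'd"
  assumes V: "finite V" "0 \<notin> V" and i: "i \<in> V"
  shows "(\<Sum>j \<in> {j \<in> cone_vertices V. {i, j} \<in> cone_edges V E}.
      \<omega> {i, j} *\<^sub>R (cone_placement p i - cone_placement p j)) =
    extend_vec ((\<Sum>j \<in> {j \<in> V. {i, j} \<in> E}. \<omega> {i, j} *\<^sub>R (p i - p j)) + \<omega> {0, i} *\<^sub>R p i)
      (\<omega> {0, i})"
proof -
  have nz: "j \<noteq> 0" if "j \<in> V" for j using that V by metis
  let ?N = "{j \<in> V. {i, j} \<in> E}"
  have N: "{j \<in> cone_vertices V. {i, j} \<in> cone_edges V E} = insert 0 ?N"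
    using i mem_cone_edges_base[OF V(2) i]
    by (auto simp: cone_vertices_def cone_edges_def insert_commute)
  have "(\<Sum>j \<in> ?N. \<omega> {i, j} *\<^sub>R (cone_placement p i - cone_placement p j)) =
      (\<Sum>j \<in> ?N. extend_vec (\<omega> {i, j} *\<^sub>R (p i - p j)) 0)"
    using nz i by (intro sum.cong) (auto simp: cone_placement_base vec_option_eq_iff)
  then show ?thesis
    using V nz[OF i] unfolding N
    by (simp add: cone_placement_base vec_option_eq_iff insert_commute)
qed

lemma self_stresses_cone:
  fixes p :: "nat \<Rightarrow> real ^ 'd"
  assumes G: "simple_graph V E" and V: "0 \<notin> V"
  shows "self_stresses (cone_vertices V) (cone_edges V E) (cone_placement p) = self_stresses V E p"
proof (intro equalityI subsetI)
  have fin: "finite V" using G by (simp add: simple_graph_def)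
  have joint: "{0, i} \<notin> E" for i
  proof
    assume "{0, i} \<in> E"
    then obtain a b where "a \<in> V" "b \<in> V" "{0, i} = {a, b}"
      using G unfolding simple_graph_def by blast
    then show False using V by (auto simp: doubleton_eq_iff)
  qed
  note base = cone_stress_sum_base[OF fin V]
  {
    fix \<omega>
    assume \<omega>: "\<omega> \<in> self_stresses (cone_vertices V) (cone_edges V E) (cone_placement p)"
    have cone: "extend_vec ((\<Sum>j \<in> {j \<in> V. {i, j} \<in> E}. \<omega> {i, j} *\<^sub>R (p i - p j)) + \<omega> {0, i} *\<^sub>R p i)
      (\<omega> {0, i}) = 0" if "i \<in> V" for i
      unfolding base[OF that, symmetric]
      using \<omega> that by (simp add: self_stresses_def cone_vertices_def)
    have eq: "\<omega> {0, i} = 0 \<and> (\<Sum>j \<in> {j \<in> V. {i, j} \<in> E}. \<omega> {i, j} *\<^sub>R (p i - p j)) = 0"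
      if "i \<in> V" for i
      using cone[OF that] by (auto simp: extend_vec_eq_0_iff)
    moreover have "\<omega> e = 0" if "e \<notin> E" for e
    proof (cases "e \<in> cone_edges V E")
      case True
      then show ?thesis using that eq by (auto simp: cone_edges_def)
    next
      case False
      then show ?thesis using \<omega> by (simp add: self_stresses_def)
    qed
    ultimately show "\<omega> \<in> self_stresses V E p" by (simp add: self_stresses_def)
  }
  {
    fix \<omega>
    assume \<omega>: "\<omega> \<in> self_stresses V E p"
    have zero: "\<omega> {0, i} = 0" for i
      using \<omega> joint by (simp add: self_stresses_def)
    have "(\<Sum>j \<in> {j \<in> cone_vertices V. {i, j} \<in> cone_edges V E}.
      \<omega> {i, j} *\<^sub>R (cone_placement p i - cone_placement p j)) = 0" if "i \<in> cone_vertices V" for i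
    proof (cases "i = 0")
      case True
      then show ?thesis using zero by simp
    next
      case False
      then have "i \<in> V" using that by (simp add: cone_vertices_def)
      then show ?thesis
        using \<omega> unfolding base[OF \<open>i \<in> V\<close>] by (simp add: zero self_stresses_def)
    qed
    moreover have "\<omega> e = 0" if "e \<notin> cone_edges V E" for e
      using \<omega> that by (simp add: self_stresses_def cone_edges_def)
    ultimately show "\<omega> \<in> self_stresses (cone_vertices V) (cone_edges V E) (cone_placement p)"
      by (simp add: self_stresses_def)
  }
qed

section \<open>Coning\<close>

theorem theorem3p1:
  fixes n :: nat and E :: "nat set set" and p :: "nat \<Rightarrow> real ^ 'd"
  assumes "framework {1..n} E p"
  shows
    "subspace_isomorphic
       (inf_motions {1..n} E p)
       {u \<in> inf_motions (cone_vertices {1..n}) (cone_edges {1..n} E) (cone_placement p). u 0 = 0}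
     \<and> subspace_isomorphic
       (trivial_inf_motions {1..n} E p)
       {u \<in> trivial_inf_motions (cone_vertices {1..n}) (cone_edges {1..n} E) (cone_placement p). u 0 = 0}
     \<and> (has_nontrivial_inf_motion {1..n} E p \<longleftrightarrow>
        has_nontrivial_inf_motion (cone_vertices {1..n}) (cone_edges {1..n} E) (cone_placement p))
     \<and> subspace_isomorphic
       (self_stresses {1..n} E p)
       (self_stresses (cone_vertices {1..n}) (cone_edges {1..n} E) (cone_placement p))
     \<and> (inf_rigid {1..n} E p \<longleftrightarrow>
        inf_rigid (cone_vertices {1..n}) (cone_edges {1..n} E) (cone_placement p))
     \<and> (isostatic {1..n} E p \<longleftrightarrow>
        isostatic (cone_vertices {1..n}) (cone_edges {1..n} E) (cone_placement p))"
proof (intro conjI)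
  let ?V = "{1..n}"
  let ?V' = "cone_vertices ?V" and ?E' = "cone_edges ?V E" and ?p' = "cone_placement p"
  have V: "0 \<notin> ?V" by simp
  have G: "simple_graph ?V E" using assms by (simp add: framework_def)
  note stresses = self_stresses_cone[OF G V, of p]
  note rigid = inf_rigid_cone_iff[OF V, of E p]
  show "subspace_isomorphic (inf_motions ?V E p) {u \<in> inf_motions ?V' ?E' ?p'. u 0 = 0}"
    using linear_cone_motion subspace_inf_motions inj_on_subset[OF inj_cone_motion subset_UNIV]
      cone_motion_image[OF V]
    by (rule subspace_isomorphic_linear_image)
  show "subspace_isomorphic (trivial_inf_motions ?V E p)
      {u \<in> trivial_inf_motions ?V' ?E' ?p'. u 0 = 0}"
    using linear_cone_motion subspace_trivial_inf_motions
      inj_on_subset[OF inj_cone_motion subset_UNIV] cone_motion_image_trivial[OF V]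
    by (rule subspace_isomorphic_linear_image)
  show "has_nontrivial_inf_motion ?V E p \<longleftrightarrow> has_nontrivial_inf_motion ?V' ?E' ?p'"
    using rigid by (simp add: has_nontrivial_inf_motion_iff)
  show "subspace_isomorphic (self_stresses ?V E p) (self_stresses ?V' ?E' ?p')"
    unfolding stresses
    by (rule subspace_isomorphic_linear_image[OF linear_ident subspace_self_stresses]) auto
  show "inf_rigid ?V E p \<longleftrightarrow> inf_rigid ?V' ?E' ?p'"
    using rigid by simp
  show "isostatic ?V E p \<longleftrightarrow> isostatic ?V' ?E' ?p'"
    using rigid stresses by (simp add: isostatic_def stress_independent_def)
qed

end
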